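(* For $|q|<1$ the following four identities hold: \begin{align*} &(-q,-q^{4};q^{5})_{\infty}^{2}(q^{4},q^{6};q^{10})_{\infty}+(-q^{2},-q^{3};q^{5})_{\infty}^{2}(q^{2},q^{8};q^{10})_{\infty}\\ &\qquad=\frac{2(q^{10};q^{10})_{\infty}^{3}}{(q^{2};q^{2})_{\infty}(q^{5};q^{5})_{\infty}^{2}}(-q,-q^{4};q^{5})_{\infty}(q^{4},q^{6};q^{10})_{\infty}^{3},\\ &(q,q^{4};q^{5})_{\infty}^{2}(q^{4},q^{6};q^{10})_{\infty}+(q^{2},q^{3};q^{5})_{\infty}^{2}(q^{2},q^{8};q^{10})_{\infty}\\ &\qquad=\frac{2(q;q)_{\infty}^{2}(q^{10};q^{10})_{\infty}^{4}}{(q^{2};q^{2})_{\infty}^{2}(q^{5};q^{5})_{\infty}^{4}}(-q,-q^{4};q^{5})_{\infty}(q^{4},q^{6};q^{10})_{\infty}^{3},\\ &(-q,-q^{4};q^{5})_{\infty}(q^{4},q^{6};q^{10})_{\infty}^{3}-q(-q^{2},-q^{3};q^{5})_{\infty}(q^{2},q^{8};q^{10})_{\infty}^{3}\\ &\qquad=\frac{(q^{2};q^{2})_{\infty}(q^{5};q^{5})_{\infty}^{2}}{(q^{10};q^{10})_{\infty}^{3}}(-q^{2},-q^{3};q^{5})_{\infty}^{2}(q^{2},q^{8};q^{10})_{\infty},\\ &(-q,-q^{4};q^{5})_{\infty}(q^{4},q^{6};q^{10})_{\infty}^{3}+q(-q^{2},-q^{3};q^{5})_{\infty}(q^{2},q^{8};q^{10})_{\infty}^{3}\\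 &\qquad=\frac{(q^{2};q^{2})_{\infty}^{2}(q^{5};q^{5})_{\infty}^{4}}{(q;q)_{\infty}^{2}(q^{10};q^{10})_{\infty}^{4}}(q^{2},q^{3};q^{5})_{\infty}^{2}(q^{2},q^{8};q^{10})_{\infty}. \end{align*}
   Context: Notation: for $|q|<1$, $(a;q)_{\infty}:=\prod_{n=0}^{\infty}(1-aq^{n})$ and $(a_{1},\ldots,a_{m};q)_{\infty}:=(a_{1};q)_{\infty}\cdots(a_{m};q)_{\infty}$; similarly with $q$ replaced by $q^k$ in the base. *)

theory Defs
  imports "HOL-Analysis.Analysis"
begin

(* (a; q)_inf = (1 - a) (1 - a q) (1 - a q^2) ...  The product converges for norm q < 1;
   outside that range prodinf may have no meaningful value. *)
definition qpoch_inf :: "complex \<Rightarrow> complex \<Rightarrow> complex" where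
  "qpoch_inf a q = (\<Prod>n. 1 - a * q ^ n)"

(* (a_1, ..., a_m; q)_inf = (a_1; q)_inf ... (a_m; q)_inf *)
definition qpochs_inf :: "complex list \<Rightarrow> complex \<Rightarrow> complex" where
  "qpochs_inf as q = (\<Prod>a\<leftarrow>as. qpoch_inf a q)"

end

theory Submission
  imports Defs
begin

text \<open>
  Write \<open>\<theta>(x; p) = (x, p/x; p)\<^sub>\<infinity>\<close> and \<open>E\<^sub>k = (q^k; q^k)\<^sub>\<infinity>\<close>. Apart from \<open>q\<close> and the \<open>E\<^sub>k\<close>, the
  four identities involve only
  \<open>A, B, a, b = \<theta>(-q), \<theta>(-q^2), \<theta>(q), \<theta>(q^2)\<close> with nome \<open>q^5\<close> and
  \<open>C, D = \<theta>(q^4), \<theta>(q^2)\<close> with nome \<open>q^10\<close>. Pairing the factors \<open>1 - z\<close> and \<open>1 + z\<close> gives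
  \<open>C = b B\<close> and \<open>D = a A\<close>. After this substitution the left-hand sides become, in order,
  \<open>A B (a B + A b)\<close>, \<open>a b (a B + A b)\<close>, \<open>A B (b^3 B^2 - q a^3 A^2)\<close> and
  \<open>A B (b^3 B^2 + q a^3 A^2)\<close>, so that everything follows from the two relations

    \<open>E\<^sub>2 E\<^sub>5^2 (a B + A b) = 2 E\<^sub>10^3 b^3 B^2\<close>  and  \<open>E\<^sub>2 E\<^sub>5^2 (A b - a B) = 2 q E\<^sub>10^3 a^3 A^2\<close>:

  the first one gives the first two identities, and half the difference and half the sum of the two
  give the last two.

  The combinations \<open>\<theta>(x) \<theta>(-y) \<plusminus> \<theta>(-x) \<theta>(y)\<close> with nome \<open>p\<close> are, up to elementary
  factors and the \<open>(p^i; p^i)\<^sub>\<infinity>\<close>, single products of two theta functions with nome \<open>p^2\<close> (lemmas \<open>theta_prod_sum\<close> and \<open>theta_prod_difference\<close>). To see this, expand both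
  factors by the Jacobi triple product. The result is a double series over pairs \<open>(m, n)\<close> whose
  exponent is a quadratic form that the rotation \<open>(m, n) = (r + s, r - s)\<close> diagonalises. The
  rotation covers the pairs with \<open>m + n\<close> even, and a shifted one the pairs with \<open>m + n\<close> odd;
  adding or subtracting the expansions for \<open>(x, -y)\<close> and \<open>(-x, y)\<close> isolates one of the two classes.
  For \<open>x = q\<close>, \<open>y = q^2\<close>, \<open>p = q^5\<close> the products on the right are \<open>\<theta>(q^3; q^10) C\<close> and \<open>D \<theta>(q; q^10)\<close>, and the extra
  factors are removed by regrouping infinite products along residue classes:
  \<open>b = D \<theta>(q^3; q^10)\<close>, \<open>a = \<theta>(q; q^10) C\<close>, \<open>E\<^sub>1 = a b E\<^sub>5\<close> and \<open>E\<^sub>2 = D C E\<^sub>10\<close>.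

  The Jacobi triple product is obtained as the limit \<open>N \<rightarrow> \<infinity>\<close> of the \<open>q\<close>-binomial theorem for
  \<open>2 N\<close> factors, centred at its middle coefficient.
\<close>

section \<open>Infinite \<open>q\<close>-shifted factorials\<close>

lemma qpoch_convergent:
  fixes a q :: complex
  assumes "norm q < 1"
  shows "convergent_prod (\<lambda>n. 1 - a * q ^ n)"
proof -
  have "summable (\<lambda>n. norm (a * q ^ n))"
    using assms by (simp add: norm_mult norm_power summable_mult)
  then have "abs_convergent_prod (\<lambda>n. 1 - a * q ^ n)"
    by (simp add: abs_convergent_prod_conv_summable)
  then show ?thesis
    by (rule abs_convergent_prod_imp_convergent_prod)
qed

lemma qpoch_tendsto:
  fixes a q :: complex
  assumes "norm q < 1"
  shows "(\<lambda>N. \<Prod>k<N. 1 - a * q ^ k) \<longlonglongrightarrow> qpoch_inf a q"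
proof -
  have "(\<lambda>N. \<Prod>k\<le>N. 1 - a * q ^ k) \<longlonglongrightarrow> qpoch_inf a q"
    unfolding qpoch_inf_def by (intro convergent_prod_LIMSEQ qpoch_convergent assms)
  then show ?thesis
    by (subst filterlim_sequentially_Suc [symmetric]) (simp only: lessThan_Suc_atMost)
qed

lemma qpoch_inf_nonzero:
  fixes a q :: complex
  assumes "norm q < 1" "norm a < 1"
  shows "qpoch_inf a q \<noteq> 0"
  unfolding qpoch_inf_def
proof (rule prodinf_nonzero)
  show "convergent_prod (\<lambda>n. 1 - a * q ^ n)"
    by (rule qpoch_convergent) fact
  fix n
  have "norm (a * q ^ n) \<le> norm a"
    using assms by (simp add: norm_mult norm_power mult_left_le power_le_one)
  with assms have "norm (a * q ^ n) < 1" by linarith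
  then show "1 - a * q ^ n \<noteq> 0" by auto
qed

lemma qpoch_inf_mult_uminus:
  assumes "norm q < 1"
  shows "qpoch_inf a q * qpoch_inf (-a) q = qpoch_inf (a^2) (q^2)"
proof -
  have "qpoch_inf a q * qpoch_inf (-a) q = (\<Prod>n. (1 - a * q ^ n) * (1 - (-a) * q ^ n))"
    unfolding qpoch_inf_def by (intro prodinf_mult qpoch_convergent assms)
  also have "\<dots> = qpoch_inf (a^2) (q^2)"
    unfolding qpoch_inf_def
    by (intro prodinf_cong) (simp add: algebra_simps power2_eq_square power_mult_distrib)
  finally show ?thesis .
qed

text \<open>
  The factors are grouped by their index modulo \<open>k\<close>. It is enough to do this for the partial
  products of length \<open>N k\<close>, which avoids any discussion of rearrangements.
\<close>

lemma qpoch_inf_dissect: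
  fixes a q :: complex
  assumes q: "norm q < 1" and k: "k > 0"
  shows "qpoch_inf a q = (\<Prod>i<k. qpoch_inf (a * q ^ i) (q ^ k))"
proof (rule LIMSEQ_unique)
  have "norm (q ^ k) < 1"
    using q k by (simp add: norm_power power_less_one_iff)
  then show "(\<lambda>N. \<Prod>i<k. \<Prod>n<N. 1 - (a * q ^ i) * (q ^ k) ^ n)
          \<longlonglongrightarrow> (\<Prod>i<k. qpoch_inf (a * q ^ i) (q ^ k))"
    by (intro tendsto_prod qpoch_tendsto)
  have "(\<lambda>N. \<Prod>i<N * k. 1 - a * q ^ i) \<longlonglongrightarrow> qpoch_inf a q"
    using k by (intro filterlim_compose[OF qpoch_tendsto[OF q]]
        filterlim_at_top_mono[OF filterlim_ident] always_eventually) auto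
  moreover have "(\<Prod>i<N * k. 1 - a * q ^ i) = (\<Prod>i<k. \<Prod>n<N. 1 - (a * q ^ i) * (q ^ k) ^ n)" for N
  proof -
    have "(\<Prod>i<N * k. 1 - a * q ^ i) = (\<Prod>n<N. \<Prod>i=n*k..<n*k+k. 1 - a * q ^ i)"
      by (rule prod.nat_group [symmetric])
    also have "\<dots> = (\<Prod>n<N. \<Prod>i<k. 1 - a * q ^ (n * k + i))"
      by (simp add: prod.atLeastLessThan_shift_0 atLeast0LessThan)
    also have "\<dots> = (\<Prod>i<k. \<Prod>n<N. 1 - a * q ^ (n * k + i))"
      by (rule prod.swap)
    finally show ?thesis
      by (simp add: power_add power_mult [symmetric] mult_ac)
  qed
  ultimately show "(\<lambda>N. \<Prod>i<k. \<Prod>n<N. 1 - (a * q ^ i) * (q ^ k) ^ n) \<longlonglongrightarrow> qpoch_inf a q"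
    by simp
qed

section \<open>The \<open>q\<close>-binomial theorem\<close>

text \<open>
  Defining the coefficients by a Pascal recursion, rather than as quotients of \<open>q\<close>-factorials, makes
  them available in every commutative ring, also when \<open>p\<close> is a root of unity.
\<close>

fun gauss_binomial :: "'a::comm_ring_1 \<Rightarrow> nat \<Rightarrow> nat \<Rightarrow> 'a" where
  "gauss_binomial p n 0 = 1"
| "gauss_binomial p 0 (Suc k) = 0"
| "gauss_binomial p (Suc n) (Suc k) =
     p ^ Suc k * gauss_binomial p n (Suc k) + gauss_binomial p n k"

lemma gauss_binomial_eq_0: "n < k \<Longrightarrow> gauss_binomial p n k = 0"
  by (induction p n k rule: gauss_binomial.induct) auto

text \<open>
  The recursion mirrors splitting off the factor \<open>1 + x\<close>, which leaves the same product of one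
  factor fewer at \<open>x p\<close>; this is why the induction has to vary \<open>x\<close>.
\<close>

theorem q_binomial_theorem:
  fixes p x :: "'a::comm_ring_1"
  shows "(\<Prod>k<n. 1 + x * p ^ k) = (\<Sum>k\<le>n. gauss_binomial p n k * p ^ (k * (k - 1) div 2) * x ^ k)"
proof (induction n arbitrary: x)
  case 0
  then show ?case by simp
next
  case (Suc n)
  let ?t = "\<lambda>k. p ^ (k * (k - 1) div 2)"
  let ?g = "gauss_binomial p"
  have t: "?t (Suc k) = p ^ k * ?t k" for k
  proof -
    have "Suc k * (Suc k - 1) div 2 = (2 * k + k * (k - 1)) div 2"
      by (cases k) (auto simp: algebra_simps)
    also have "\<dots> = k + k * (k - 1) div 2" by simp
    finally show ?thesis by (simp add: power_add)
  qed
  have "(\<Prod>k<Suc n. 1 + x * p ^ k) = (1 + x) * (\<Prod>k<n. 1 + (x * p) * p ^ k)"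
    by (simp add: prod.lessThan_Suc_shift mult_ac del: prod.lessThan_Suc)
  also have "\<dots> = (1 + x) * (\<Sum>k\<le>n. ?g n k * ?t k * (x * p) ^ k)"
    by (simp only: Suc.IH)
  also have "\<dots> = (\<Sum>k\<le>Suc n. ?g n k * ?t k * (x * p) ^ k) + x * (\<Sum>k\<le>n. ?g n k * ?t k * (x * p) ^ k)"
    by (simp add: gauss_binomial_eq_0 algebra_simps)
  also have "(\<Sum>k\<le>Suc n. ?g n k * ?t k * (x * p) ^ k) =
      1 + (\<Sum>k\<le>n. p ^ Suc k * ?g n (Suc k) * ?t (Suc k) * x ^ Suc k)"
    by (subst sum.atMost_Suc_shift) (simp add: power_mult_distrib mult_ac)
  also have "x * (\<Sum>k\<le>n. ?g n k * ?t k * (x * p) ^ k) = (\<Sum>k\<le>n. ?g n k * ?t (Suc k) * x ^ Suc k)"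
    unfolding t by (simp add: sum_distrib_left power_mult_distrib mult_ac)
  also have "1 + (\<Sum>k\<le>n. p ^ Suc k * ?g n (Suc k) * ?t (Suc k) * x ^ Suc k) + \<dots> =
      1 + (\<Sum>k\<le>n. ?g (Suc n) (Suc k) * ?t (Suc k) * x ^ Suc k)"
    by (simp add: sum.distrib [symmetric] distrib_right add.assoc del: power_Suc)
  also have "\<dots> = (\<Sum>k\<le>Suc n. ?g (Suc n) k * ?t k * x ^ k)"
    by (subst sum.atMost_Suc_shift) simp
  finally show ?case .
qed

text \<open>
  The link to \<open>q\<close>-factorials \<open>P n = (p; p)\<^sub>n\<close>, free of divisions. It is what controls the coefficients
  when \<open>n\<close> grows.
\<close>

lemma gauss_binomial_fact:
  fixes p :: "'a::comm_ring_1"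
  defines "P \<equiv> \<lambda>n. \<Prod>i<n. 1 - p * p ^ i"
  assumes "k \<le> n"
  shows "gauss_binomial p n k * P k * P (n - k) = P n"
  using assms(2)
proof (induction n arbitrary: k)
  case 0
  then show ?case by (simp add: P_def)
next
  case (Suc n)
  have P_Suc: "P (Suc n) = P n * (1 - p ^ Suc n)" for n
    by (simp add: P_def)
  show ?case
  proof (cases k)
    case 0
    then show ?thesis by (simp add: P_def)
  next
    case (Suc k')
    with Suc.prems have k': "k' \<le> n" by simp
    have 1: "gauss_binomial p n (Suc k') * P (Suc k') * P (n - k') = P n * (1 - p ^ (n - k'))"
    proof (cases "k' = n")
      case True
      then show ?thesis by (simp add: gauss_binomial_eq_0)
    next
      case False
      with k' have "n - k' = Suc (n - Suc k')" by simp
      then have "P (n - k') = P (n - Suc k') * (1 - p ^ (n - k'))"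
        using P_Suc[of "n - Suc k'"] by simp
      moreover have "gauss_binomial p n (Suc k') * P (Suc k') * P (n - Suc k') = P n"
        using False k' by (intro Suc.IH) simp
      ultimately show ?thesis by (simp add: mult.assoc [symmetric])
    qed
    have 2: "gauss_binomial p n k' * P (Suc k') * P (n - k') = P n * (1 - p ^ Suc k')"
      using Suc.IH[OF k', symmetric] unfolding P_Suc[of k'] by (simp add: mult_ac)
    have "gauss_binomial p (Suc n) k * P k * P (Suc n - k)
        = p ^ Suc k' * (gauss_binomial p n (Suc k') * P (Suc k') * P (n - k'))
          + gauss_binomial p n k' * P (Suc k') * P (n - k')"
      unfolding Suc by (simp add: algebra_simps)
    also have "\<dots> = P n * (1 - p ^ Suc k' * p ^ (n - k'))"
      unfolding 1 2 by (simp add: algebra_simps)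
    also have "p ^ Suc k' * p ^ (n - k') = p ^ Suc n"
      using k' by (simp del: power_Suc flip: power_add)
    finally show ?thesis unfolding P_Suc .
  qed
qed

section \<open>Theta functions as products and as series\<close>

text \<open>
  Absolute summability is meant in the sense of integrability for the counting measure, which gives
  access to dominated convergence.
\<close>

no_notation Infinite_Sum.abs_summable_on (infixr \<open>abs'_summable'_on\<close> 46)

definition theta_prod :: "complex \<Rightarrow> complex \<Rightarrow> complex" where
  "theta_prod x p = qpoch_inf x p * qpoch_inf (p / x) p"

definition tri :: "int \<Rightarrow> int" where
  "tri n = n * (n - 1) div 2"

text \<open>
  The usual sign \<open>(-1)^n\<close> is absorbed into the power of \<open>-x\<close>.
\<close>

definition theta_term :: "complex \<Rightarrow> complex \<Rightarrow> int \<Rightarrow> complex" where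
  "theta_term x p n = p powi tri n * (-x) powi n"

lemma double_triangular: "2 * tri n = n * (n - 1)"
  unfolding tri_def by (rule dvd_mult_div_cancel) simp

lemma prod_lessThan_add:
  fixes f :: "nat \<Rightarrow> 'a::comm_monoid_mult"
  shows "(\<Prod>k<m+n. f k) = (\<Prod>k<m. f k) * (\<Prod>k<n. f (m + k))"
  by (induction n) (simp_all add: mult_ac)

text \<open>
  This is the \<open>q\<close>-binomial theorem for \<open>2 N\<close> factors at \<open>y = - x / p^N\<close>. The upper half of the product is
  then \<open>\<Prod>k<N. 1 - x p^k\<close>; in the lower half each factor \<open>1 - x / p^(k+1)\<close> equals
  \<open>1 - p^(k+1) / x\<close> times \<open>- x / p^(k+1)\<close>. The constant \<open>c\<close> collects these monomials, and dividing
  by it turns the exponents \<open>k (k - 1) / 2\<close> into the exponents centred at \<open>k = N\<close>.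
\<close>

lemma finite_jacobi_triple_product:
  assumes p: "p \<noteq> 0" and x: "x \<noteq> 0"
  shows "(\<Prod>k<N. 1 - x * p ^ k) * (\<Prod>k<N. 1 - p / x * p ^ k)
       = (\<Sum>k\<le>N+N. gauss_binomial p (N+N) k * theta_term x p (int k - int N))"
proof -
  define y where "y = - x / p ^ N"
  define c where "c = (-x) ^ N / p ^ (N * (N + 1) div 2)"
  have c: "c \<noteq> 0"
    using p x by (simp add: c_def)
  have c_prod: "c = (\<Prod>k<N. - x / p ^ Suc k)"
  proof -
    have "(\<Prod>k<M. - x / p ^ Suc k) = (-x) ^ M / p ^ (M * (M + 1) div 2)" for M
    proof (induction M)
      case (Suc M)
      have "Suc M * (Suc M + 1) div 2 = M * (M + 1) div 2 + Suc M"
        by simp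
      then show ?case
        using Suc by (simp add: power_add mult_ac)
    qed simp
    then show ?thesis by (simp add: c_def)
  qed
  have "(\<Prod>k<N. 1 + y * p ^ k) = (\<Prod>k<N. 1 + y * p ^ (N - Suc k))"
    by (rule prod.nat_diff_reindex [symmetric])
  also have "\<dots> = (\<Prod>k<N. (- x / p ^ Suc k) * (1 - p / x * p ^ k))"
  proof (rule prod.cong)
    fix k assume "k \<in> {..<N}"
    then have "p ^ N = p ^ (N - Suc k) * p ^ Suc k"
      by (simp del: power_Suc flip: power_add)
    then show "1 + y * p ^ (N - Suc k) = (- x / p ^ Suc k) * (1 - p / x * p ^ k)"
      using p x by (simp add: y_def field_simps)
  qed simp
  also have "\<dots> = c * (\<Prod>k<N. 1 - p / x * p ^ k)"
    unfolding c_prod by (rule prod.distrib)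
  finally have lower: "(\<Prod>k<N. 1 + y * p ^ k) = c * (\<Prod>k<N. 1 - p / x * p ^ k)" .
  have upper: "(\<Prod>k<N. 1 + y * p ^ (N + k)) = (\<Prod>k<N. 1 - x * p ^ k)"
    using p by (simp add: y_def power_add)
  have "c * ((\<Prod>k<N. 1 - x * p ^ k) * (\<Prod>k<N. 1 - p / x * p ^ k)) = (\<Prod>k<N+N. 1 + y * p ^ k)"
    by (simp add: prod_lessThan_add lower upper)
  also have "\<dots> = (\<Sum>k\<le>N+N. gauss_binomial p (N+N) k * p ^ (k * (k - 1) div 2) * y ^ k)"
    by (rule q_binomial_theorem)
  also have "\<dots> = (\<Sum>k\<le>N+N. c * (gauss_binomial p (N+N) k * theta_term x p (int k - int N)))"
  proof (rule sum.cong)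
    fix k
    have "tri (int k - int N) = tri (int k) + tri (int N + 1) - int N * int k"
      using double_triangular[of "int k - int N"] double_triangular[of "int k"]
        double_triangular[of "int N + 1"] by (simp add: algebra_simps)
    moreover have "tri (int k) = int (k * (k - 1) div 2)"
      by (cases k) (simp_all add: tri_def zdiv_int algebra_simps)
    moreover have "tri (int N + 1) = int (N * (N + 1) div 2)"
      by (simp add: tri_def zdiv_int algebra_simps)
    ultimately have "p powi tri (int k - int N)
        = p ^ (k * (k - 1) div 2) * p ^ (N * (N + 1) div 2) / (p ^ N) ^ k"
      using p by (simp only: power_int_diff power_int_add power_int_of_nat power_mult
          simp_thms flip: of_nat_mult)
    moreover have "(- x) powi (int k - int N) = (- x) ^ k / (- x) ^ N"
      using x by (simp add: power_int_diff)
    ultimately have "c * theta_term x p (int k - int N) = p ^ (k * (k - 1) div 2) * y ^ k"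
      unfolding theta_term_def c_def y_def power_divide using p x by simp
    then show "gauss_binomial p (N+N) k * p ^ (k * (k - 1) div 2) * y ^ k
        = c * (gauss_binomial p (N+N) k * theta_term x p (int k - int N))"
      by (simp add: mult_ac)
  qed simp
  also have "\<dots> = c * (\<Sum>k\<le>N+N. gauss_binomial p (N+N) k * theta_term x p (int k - int N))"
    by (simp add: sum_distrib_left)
  finally show ?thesis using c by simp
qed

text \<open>
  The termwise form of the symmetry under \<open>x \<mapsto> 1/x\<close>. It reduces convergence at negative indices to
  convergence at positive ones.
\<close>

lemma theta_term_reflect:
  assumes "x \<noteq> 0"
  shows "theta_term x p (1 - n) = - x * theta_term (1 / x) p n"
proof -
  have "tri (1 - n) = tri n"
    by (simp add: tri_def algebra_simps)
  moreover have "(- x) powi (1 - n) = - x * (- (1 / x)) powi n"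
    using assms by (simp add: power_int_diff power_int_minus_left power_int_divide_distrib divide_simps)
  ultimately show ?thesis by (simp add: theta_term_def)
qed

lemma theta_term_summable_nat:
  assumes "norm p < 1" "p \<noteq> 0" "x \<noteq> 0"
  shows "summable (\<lambda>n. norm (theta_term x p (int n)))"
proof -
  have step: "theta_term x p (int (Suc n)) = - (x * p ^ n) * theta_term x p (int n)" for n
  proof -
    have "tri (int (Suc n)) = int n + tri (int n)"
      using double_triangular[of "int (Suc n)"] double_triangular[of "int n"]
      by (simp add: algebra_simps)
    then show ?thesis
      using assms by (simp add: theta_term_def power_int_add del: of_nat_Suc)
  qed
  have "(\<lambda>n. norm (x * p ^ n)) \<longlonglongrightarrow> norm (x * 0)"
    using assms by (intro tendsto_norm tendsto_mult tendsto_const LIMSEQ_power_zero)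
  then have "eventually (\<lambda>n. norm (x * p ^ n) < 1/2) sequentially"
    by (intro order_tendstoD) auto
  then obtain N where N: "\<And>n. n \<ge> N \<Longrightarrow> norm (x * p ^ n) < 1/2"
    by (auto simp: eventually_sequentially)
  show ?thesis
  proof (rule summable_ratio_test)
    fix n assume "n \<ge> N"
    then have "norm (x * p ^ n) * norm (theta_term x p (int n)) \<le> 1/2 * norm (theta_term x p (int n))"
      using N[of n] by (intro mult_right_mono) auto
    then show "norm (norm (theta_term x p (int (Suc n)))) \<le> 1/2 * norm (norm (theta_term x p (int n)))"
      unfolding step by (simp add: norm_mult)
  qed simp
qed

lemma theta_term_summable:
  assumes "norm p < 1" "p \<noteq> 0" "x \<noteq> 0"
  shows "theta_term x p abs_summable_on UNIV"
proof -
  have 1: "theta_term y p abs_summable_on range int" if "y \<noteq> 0" for y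
    by (rule abs_summable_on_reindex)
       (use theta_term_summable_nat[OF assms(1,2) that] in \<open>simp add: abs_summable_on_nat_iff'\<close>)
  have "theta_term x p abs_summable_on range (\<lambda>n. 1 - int n)"
    by (rule abs_summable_on_reindex)
       (use assms theta_term_summable_nat[of p "1/x"] in
         \<open>simp add: theta_term_reflect abs_summable_on_nat_iff' norm_mult summable_mult\<close>)
  with 1[OF assms(3)] have "theta_term x p abs_summable_on (range int \<union> range (\<lambda>n. 1 - int n))"
    by blast
  moreover have "range int \<union> range (\<lambda>n. 1 - int n) = UNIV"
  proof -
    have "n \<in> range int \<union> range (\<lambda>n. 1 - int n)" for n :: int
    proof (cases "n \<ge> 0")
      case True
      then have "n = int (nat n)" by simp
      then show ?thesis by blast
    next
      case False
      then have "n = 1 - int (nat (1 - n))" by simp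
      then show ?thesis by blast
    qed
    then show ?thesis by blast
  qed
  ultimately show ?thesis by simp
qed

section \<open>The Jacobi triple product\<close>

lemma gauss_binomial_eq_quotient:
  fixes p :: complex
  assumes "norm p < 1" "k \<le> n"
  shows "gauss_binomial p n k
       = (\<Prod>i<n. 1 - p * p ^ i) / ((\<Prod>i<k. 1 - p * p ^ i) * (\<Prod>i<n-k. 1 - p * p ^ i))"
proof -
  have "norm (p * p ^ i) < 1" for i
    using assms(1) power_Suc_less_one[of "norm p" i] by (simp add: norm_mult norm_power power_less_one_iff flip: power_Suc)
  then have "1 - p * p ^ i \<noteq> 0" for i
    by (metis eq_iff_diff_eq_0 less_irrefl norm_one)
  then have "(\<Prod>i<m. 1 - p * p ^ i) \<noteq> 0" for m
    by simp
  then show ?thesis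
    using gauss_binomial_fact[OF assms(2), of p] by (simp add: field_simps)
qed

text \<open>
  Both facts come from the convergence of \<open>(p; p)\<^sub>n\<close> to a nonzero limit: a coefficient is a product of
  such numbers and of their inverses, so all are bounded, and at a fixed distance \<open>j\<close> from the
  middle all three indices tend to infinity.
\<close>

lemma gauss_binomial_limit_and_bound:
  fixes p :: complex
  assumes "norm p < 1"
  shows gauss_binomial_central_tendsto:
      "(\<lambda>N. gauss_binomial p (N+N) (nat (int N + j))) \<longlonglongrightarrow> 1 / qpoch_inf p p"
    and gauss_binomial_bounded: "\<exists>K. \<forall>n k. norm (gauss_binomial p n k) \<le> K"
proof -
  define P where "P = (\<lambda>n. \<Prod>i<n. 1 - p * p ^ i)"
  have lim: "P \<longlonglongrightarrow> qpoch_inf p p"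
    unfolding P_def by (rule qpoch_tendsto) fact
  have nz: "qpoch_inf p p \<noteq> 0"
    by (rule qpoch_inf_nonzero) (use assms in auto)
  have ev: "eventually (\<lambda>N. gauss_binomial p (N+N) (nat (int N + j))
      = P (N+N) / (P (nat (int N + j)) * P (nat (int N - j)))) sequentially"
    using eventually_ge_at_top[of "nat \<bar>j\<bar>"]
  proof eventually_elim
    case (elim N)
    then have "nat (int N + j) \<le> N + N" and "N + N - nat (int N + j) = nat (int N - j)"
      by auto
    then show ?case
      using gauss_binomial_eq_quotient[OF assms, of "nat (int N + j)" "N+N"] by (simp add: P_def)
  qed
  have l: "filterlim (\<lambda>N. nat (int N + i)) at_top sequentially" for i
    unfolding filterlim_at_top eventually_sequentially
  proof (intro allI exI impI)
    fix Z N assume "nat (int Z + \<bar>i\<bar>) \<le> N"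
    then show "Z \<le> nat (int N + i)" by linarith
  qed
  have l2: "filterlim (\<lambda>N::nat. N + N) at_top sequentially"
    by (rule filterlim_at_top_mono[OF filterlim_ident]) auto
  have "(\<lambda>N. P (N+N) / (P (nat (int N + j)) * P (nat (int N - j))))
      \<longlonglongrightarrow> qpoch_inf p p / (qpoch_inf p p * qpoch_inf p p)"
    using nz l[of j] l[of "-j"] l2
    by (intro tendsto_divide tendsto_mult filterlim_compose[OF lim]) auto
  then show "(\<lambda>N. gauss_binomial p (N+N) (nat (int N + j))) \<longlonglongrightarrow> 1 / qpoch_inf p p"
    using nz by (subst filterlim_cong[OF refl refl ev]) simp
  obtain M where M: "\<And>n. norm (P n) \<le> M"
    using lim by (metis Bseq_def convergentI convergent_imp_Bseq)
  have "(\<lambda>n. inverse (P n)) \<longlonglongrightarrow> inverse (qpoch_inf p p)"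
    using lim nz by (intro tendsto_inverse)
  then obtain L where L: "\<And>n. norm (inverse (P n)) \<le> L"
    by (metis Bseq_def convergentI convergent_imp_Bseq)
  have M0: "M \<ge> 0" and L0: "L \<ge> 0"
    using M[of 0] L[of 0] by (auto intro: order_trans[OF norm_ge_zero])
  have "norm (gauss_binomial p n k) \<le> M * (L * L)" for n k
  proof (cases "k \<le> n")
    case True
    then have "gauss_binomial p n k = P n * (inverse (P k) * inverse (P (n - k)))"
      using gauss_binomial_eq_quotient[OF assms True] by (simp add: P_def field_simps)
    also have "norm \<dots> \<le> M * (L * L)"
      unfolding norm_mult by (intro mult_mono M L L0 M0 mult_nonneg_nonneg norm_ge_zero)
    finally show ?thesis .
  qed (use M0 L0 in \<open>simp add: gauss_binomial_eq_0\<close>)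
  then show "\<exists>K. \<forall>n k. norm (gauss_binomial p n k) \<le> K" by blast
qed

text \<open>
  Let \<open>N\<close> tend to infinity in the finite form. The coefficients are uniformly bounded and the theta
  series converges absolutely, so dominated convergence on the counting measure of the
  integers allows taking the limit term by term.
\<close>

theorem jacobi_triple_product:
  assumes p: "norm p < 1" "p \<noteq> 0" and x: "x \<noteq> 0"
  shows "qpoch_inf p p * theta_prod x p = infsetsum (theta_term x p) UNIV"
proof -
  define s where "s = (\<lambda>N j. indicator {- int N..int N} j *
    gauss_binomial p (N+N) (nat (int N + j)) * theta_term x p j)"
  obtain K where K: "\<And>n k. norm (gauss_binomial p n k) \<le> K"
    using gauss_binomial_bounded[OF p(1)] by blast
  have "(\<lambda>N. infsetsum (s N) UNIV) \<longlonglongrightarrow> infsetsum (\<lambda>j. 1 / qpoch_inf p p * theta_term x p j) UNIV"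
    unfolding infsetsum_def
  proof (rule integral_dominated_convergence)
    show "integrable (count_space UNIV) (\<lambda>j. K * norm (theta_term x p j))"
      using theta_term_summable[OF p x] by (simp add: abs_summable_on_def)
    show "AE j in count_space UNIV. (\<lambda>N. s N j) \<longlonglongrightarrow> 1 / qpoch_inf p p * theta_term x p j"
    proof (rule AE_I2)
      fix j
      have "eventually (\<lambda>N. s N j = gauss_binomial p (N+N) (nat (int N + j)) * theta_term x p j) sequentially"
        using eventually_ge_at_top[of "nat \<bar>j\<bar>"] by eventually_elim (auto simp: s_def indicator_def)
      moreover have "(\<lambda>N. gauss_binomial p (N+N) (nat (int N + j)) * theta_term x p j)
          \<longlonglongrightarrow> 1 / qpoch_inf p p * theta_term x p j"
        by (intro tendsto_mult tendsto_const gauss_binomial_central_tendsto p)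
      ultimately show "(\<lambda>N. s N j) \<longlonglongrightarrow> 1 / qpoch_inf p p * theta_term x p j"
        by (simp add: filterlim_cong)
    qed
    show "AE j in count_space UNIV. norm (s N j) \<le> K * norm (theta_term x p j)" for N
    proof (rule AE_I2)
      fix j
      have "0 \<le> K" using K[of 0 0] norm_ge_zero order_trans by blast
      then show "norm (s N j) \<le> K * norm (theta_term x p j)"
        by (auto simp: s_def norm_mult indicator_def intro!: mult_right_mono K)
    qed
  qed auto
  moreover have "infsetsum (s N) UNIV = (\<Prod>k<N. 1 - x * p ^ k) * (\<Prod>k<N. 1 - p / x * p ^ k)" for N
  proof -
    have "infsetsum (s N) UNIV = infsetsum (s N) {- int N..int N}"
      by (rule infsetsum_cong_neutral) (auto simp: s_def)
    also have "\<dots> = (\<Sum>j=- int N..int N. s N j)"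
      by simp
    also have "\<dots> = (\<Sum>k\<le>N+N. gauss_binomial p (N+N) k * theta_term x p (int k - int N))"
      by (rule sum.reindex_bij_witness[of _ "\<lambda>k. int k - int N" "\<lambda>j. nat (int N + j)"])
         (auto simp: s_def)
    also have "\<dots> = (\<Prod>k<N. 1 - x * p ^ k) * (\<Prod>k<N. 1 - p / x * p ^ k)"
      by (rule finite_jacobi_triple_product [symmetric]) fact+
    finally show ?thesis .
  qed
  moreover have "(\<lambda>N. (\<Prod>k<N. 1 - x * p ^ k) * (\<Prod>k<N. 1 - p / x * p ^ k)) \<longlonglongrightarrow> theta_prod x p"
    unfolding theta_prod_def by (intro tendsto_mult qpoch_tendsto p)
  ultimately have "theta_prod x p = infsetsum (\<lambda>j. 1 / qpoch_inf p p * theta_term x p j) UNIV"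
    by (simp add: LIMSEQ_unique)
  also have "\<dots> = 1 / qpoch_inf p p * infsetsum (theta_term x p) UNIV"
    by (rule infsetsum_cmult_right) (use theta_term_summable[OF p x] in simp)
  finally show ?thesis
    using qpoch_inf_nonzero[of p p] p by (simp add: field_simps)
qed

section \<open>Products of two theta functions\<close>

text \<open>
  In the double series the exponent of \<open>p\<close> is \<open>tri m + tri n\<close>. The substitution \<open>(m, n) = (r + s, r - s)\<close>
  for even \<open>m + n\<close>, and \<open>(m, n) = (r + s + 1, r - s)\<close> for odd \<open>m + n\<close>, separates it into \<open>2 tri r\<close>
  and \<open>2 tri s\<close> up to linear terms. The doubling turns the nome into \<open>p^2\<close>, and the linear terms are
  absorbed into the arguments.
\<close>

lemma theta_series_mult:
  assumes p: "norm p < 1" "p \<noteq> 0" and x: "x \<noteq> 0" and y: "y \<noteq> 0"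
  defines "S \<equiv> \<lambda>x p. infsetsum (theta_term x p) UNIV"
  shows "S x p * S y p = S (-(x*y)) (p^2) * S (-(p*x/y)) (p^2)
       - x * (S (-(p*x*y)) (p^2) * S (-(p^2*x/y)) (p^2))"
proof -
  have p2: "norm (p^2) < 1" "p^2 \<noteq> 0"
    using p by (auto simp: norm_power power_less_one_iff)
  let ?t = "\<lambda>x p y q. \<lambda>(m, n). theta_term x p m * theta_term y q n"
  have prod: "?t x p y q abs_summable_on (UNIV \<times> UNIV)"
       "infsetsum (?t x p y q) (UNIV \<times> UNIV) = S x p * S y q"
    if "norm p < 1" "p \<noteq> 0" "norm q < 1" "q \<noteq> 0" "x \<noteq> 0" "y \<noteq> 0" for x y p q
    unfolding S_def using that
    by (intro abs_summable_on_product infsetsum_product theta_term_summable; simp)+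
  define f where "f = ?t x p y p"
  define Even where "Even = {(m, n). even (m + n :: int)}"
  define Odd where "Odd = {(m, n). odd (m + n :: int)}"
  define e where "e = (\<lambda>(r, s). (r + s, r - s :: int))"
  define d where "d = (\<lambda>(r, s). (r + s + 1, r - s :: int))"
  have e: "bij_betw e (UNIV \<times> UNIV) Even"
    by (rule bij_betw_byWitness[of _ "\<lambda>(m, n). ((m + n) div 2, (m - n) div 2)"])
       (auto simp: e_def Even_def, presburger+)
  have d: "bij_betw d (UNIV \<times> UNIV) Odd"
    by (rule bij_betw_byWitness[of _ "\<lambda>(m, n). ((m + n - 1) div 2, (m - n - 1) div 2)"])
       (auto simp: d_def Odd_def, presburger+)
  have sq: "(p^2) powi n = p powi (2 * n)" for n
    using p by (simp add: power_int_mult)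
  have fe: "f (e z) = ?t (-(x*y)) (p^2) (-(p*x/y)) (p^2) z" for z
  proof -
    obtain r s where z: "z = (r, s)" by fastforce
    have "tri (r + s) + tri (r - s) = 2 * tri r + 2 * tri s + s"
      using double_triangular[of "r+s"] double_triangular[of "r-s"]
        double_triangular[of r] double_triangular[of s] by (simp add: algebra_simps)
    then have "p powi tri (r + s) * p powi tri (r - s) = (p^2) powi tri r * (p^2) powi tri s * p powi s"
      using p unfolding sq by (simp only: power_int_add [symmetric] simp_thms)
    moreover have "(-x) powi (r + s) * (-y) powi (r - s) = (x*y) powi r * (x/y) powi s"
    proof -
      have "(-x) powi (r + s) * (-y) powi (r - s) = ((-x) * (-y)) powi r * ((-x) / (-y)) powi s"
        using x y by (simp only: power_int_add power_int_diff power_int_mult_distrib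
            power_int_divide_distrib neg_equal_0_iff_equal simp_thms) (simp add: field_simps)
      then show ?thesis by simp
    qed
    moreover have "f (e z) = (p powi tri (r + s) * p powi tri (r - s)) * ((-x) powi (r + s) * (-y) powi (r - s))"
      by (simp add: f_def e_def z theta_term_def)
    ultimately show ?thesis
      by (simp add: z theta_term_def power_int_mult_distrib power_int_divide_distrib)
  qed
  have fd: "f (d z) = - x * ?t (-(p*x*y)) (p^2) (-(p^2*x/y)) (p^2) z" for z
  proof -
    obtain r s where z: "z = (r, s)" by fastforce
    have "tri (r + s + 1) + tri (r - s) = 2 * tri r + 2 * tri s + r + 2 * s"
      using double_triangular[of "r+s+1"] double_triangular[of "r-s"]
        double_triangular[of r] double_triangular[of s] by (simp add: algebra_simps)
    then have "p powi tri (r + s + 1) * p powi tri (r - s)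
        = (p^2) powi tri r * (p^2) powi tri s * p powi r * (p^2) powi s"
      using p unfolding sq by (simp only: power_int_add [symmetric] simp_thms)
    moreover have "(-x) powi (r + s + 1) * (-y) powi (r - s) = - x * ((x*y) powi r * (x/y) powi s)"
    proof -
      have "(-x) powi (r + s + 1) * (-y) powi (r - s) = - x * (((-x) * (-y)) powi r * ((-x) / (-y)) powi s)"
        using x y by (simp only: power_int_add power_int_diff power_int_mult_distrib power_int_1_right
            power_int_divide_distrib neg_equal_0_iff_equal simp_thms) (simp add: field_simps)
      then show ?thesis by simp
    qed
    moreover have "f (d z) = (p powi tri (r + s + 1) * p powi tri (r - s)) * ((-x) powi (r + s + 1) * (-y) powi (r - s))"
      by (simp add: f_def d_def z theta_term_def)
    ultimately show ?thesis
      by (simp add: z theta_term_def power_int_mult_distrib power_int_divide_distrib)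
  qed
  have f: "f abs_summable_on UNIV \<times> UNIV"
    unfolding f_def using p x y by (intro prod)
  have "S x p * S y p = infsetsum f (UNIV \<times> UNIV)"
    unfolding f_def using p x y by (intro prod(2) [symmetric])
  also have "UNIV \<times> UNIV = Even \<union> Odd"
    by (auto simp: Even_def Odd_def)
  also have "infsetsum f (Even \<union> Odd) = infsetsum f Even + infsetsum f Odd"
    by (intro infsetsum_Un_disjoint abs_summable_on_subset[OF f]) (auto simp: Even_def Odd_def)
  also have "infsetsum f Even = infsetsum (\<lambda>z. f (e z)) (UNIV \<times> UNIV)"
    by (rule infsetsum_reindex_bij_betw[OF e, symmetric])
  also have "\<dots> = S (-(x*y)) (p^2) * S (-(p*x/y)) (p^2)"
    unfolding fe using p x y p2 by (intro prod(2)) auto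
  also have "infsetsum f Odd = infsetsum (\<lambda>z. f (d z)) (UNIV \<times> UNIV)"
    by (rule infsetsum_reindex_bij_betw[OF d, symmetric])
  also have "\<dots> = - x * (S (-(p*x*y)) (p^2) * S (-(p^2*x/y)) (p^2))"
    unfolding fd using prod[OF p2 p2, of "-(p*x*y)" "-(p^2*x/y)"] p x y
    by (subst infsetsum_cmult_right) simp_all
  finally show ?thesis by simp
qed

lemma theta_prod_mult:
  assumes p: "norm p < 1" "p \<noteq> 0" and x: "x \<noteq> 0" and y: "y \<noteq> 0"
  shows "qpoch_inf p p ^ 2 * (theta_prod x p * theta_prod y p) = qpoch_inf (p^2) (p^2) ^ 2 *
       (theta_prod (-(x*y)) (p^2) * theta_prod (-(p*x/y)) (p^2)
       - x * (theta_prod (-(p*x*y)) (p^2) * theta_prod (-(p^2*x/y)) (p^2)))"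
proof -
  have p2: "norm (p^2) < 1" "p^2 \<noteq> 0"
    using p by (auto simp: norm_power power_less_one_iff)
  have "qpoch_inf p p ^ 2 * (theta_prod x p * theta_prod y p)
      = (qpoch_inf p p * theta_prod x p) * (qpoch_inf p p * theta_prod y p)"
    by (simp add: power2_eq_square)
  also have "\<dots> = infsetsum (theta_term x p) UNIV * infsetsum (theta_term y p) UNIV"
    using p x y by (simp add: jacobi_triple_product)
  also have "\<dots> = (qpoch_inf (p^2) (p^2) * theta_prod (-(x*y)) (p^2)) * (qpoch_inf (p^2) (p^2) * theta_prod (-(p*x/y)) (p^2))
       - x * ((qpoch_inf (p^2) (p^2) * theta_prod (-(p*x*y)) (p^2)) * (qpoch_inf (p^2) (p^2) * theta_prod (-(p^2*x/y)) (p^2)))"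
    using p x y p2 by (simp add: theta_series_mult jacobi_triple_product)
  finally show ?thesis
    by (simp add: algebra_simps power2_eq_square)
qed

text \<open>
  Of the two terms in \<open>theta_prod_mult\<close>, the first depends only on \<open>x y\<close> and \<open>x / y\<close> and hence
  agrees for \<open>(x, -y)\<close> and \<open>(-x, y)\<close>, whereas the prefactor of the second changes
  sign with \<open>x\<close>.
\<close>

lemma theta_prod_sum_and_difference:
  assumes p: "norm p < 1" "p \<noteq> 0" and x: "x \<noteq> 0" and y: "y \<noteq> 0"
  shows theta_prod_sum: "qpoch_inf p p ^ 2 * (theta_prod x p * theta_prod (-y) p + theta_prod (-x) p * theta_prod y p)
       = 2 * qpoch_inf (p^2) (p^2) ^ 2 * (theta_prod (x*y) (p^2) * theta_prod (p*x/y) (p^2))"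
    and theta_prod_difference: "qpoch_inf p p ^ 2 * (theta_prod (-x) p * theta_prod y p - theta_prod x p * theta_prod (-y) p)
       = 2 * x * qpoch_inf (p^2) (p^2) ^ 2 * (theta_prod (p*x*y) (p^2) * theta_prod (p^2*x/y) (p^2))"
  using theta_prod_mult[OF p x, of "-y"] theta_prod_mult[OF p, of "-x" y] x y
  by (simp_all add: algebra_simps)

section \<open>Regrouping theta products\<close>

lemma theta_prod_mult_uminus:
  assumes "norm p < 1"
  shows "theta_prod x p * theta_prod (-x) p = theta_prod (x^2) (p^2)"
  using qpoch_inf_mult_uminus[OF assms, of x] qpoch_inf_mult_uminus[OF assms, of "p/x"]
  by (simp add: theta_prod_def power_divide mult_ac)

lemma theta_prod_commute: "x \<noteq> 0 \<Longrightarrow> p \<noteq> 0 \<Longrightarrow> theta_prod (p / x) p = theta_prod x p"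
  by (simp add: theta_prod_def)

lemma theta_prod_dissect:
  assumes "norm p < 1" "p \<noteq> 0" "x \<noteq> 0"
  shows "theta_prod x p = theta_prod x (p^2) * theta_prod (p * x) (p^2)"
proof -
  have "{..<2::nat} = {0, 1}" by auto
  then show ?thesis
    using qpoch_inf_dissect[of p 2 x] qpoch_inf_dissect[of p 2 "p/x"] assms
    by (simp add: theta_prod_def field_simps power2_eq_square)
qed

text \<open>
  Of the five residue classes of the exponent, 1 and 4 form one theta product, 2 and 3 another, and
  0 contributes \<open>(p^5; p^5)\<^sub>\<infinity>\<close>.
\<close>

lemma qpoch_inf_quintisect:
  assumes "norm p < 1" "p \<noteq> 0"
  shows "qpoch_inf p p = theta_prod p (p^5) * theta_prod (p^2) (p^5) * qpoch_inf (p^5) (p^5)"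
proof -
  have "{..<5::nat} = {0, 1, 2, 3, 4}" by auto
  moreover have "p ^ 5 / p = p ^ 4" "p ^ 5 / p ^ 2 = p ^ 3"
    using assms by (simp_all add: eval_nat_numeral)
  moreover have "p * p = p ^ 2" "p * p ^ 2 = p ^ 3" "p * p ^ 3 = p ^ 4" "p * p ^ 4 = p ^ 5"
    by (simp_all add: eval_nat_numeral)
  ultimately show ?thesis
    using qpoch_inf_dissect[of p 5 p] assms
    by (simp add: theta_prod_def)
qed

section \<open>The four identities\<close>

theorem theorem1p7:
  fixes q :: complex
  assumes "norm q < 1"
  shows
    "((qpochs_inf [-q, -(q^4)] (q^5))^2 * qpochs_inf [q^4, q^6] (q^10)
       + (qpochs_inf [-(q^2), -(q^3)] (q^5))^2 * qpochs_inf [q^2, q^8] (q^10)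
     = 2 * (qpoch_inf (q^10) (q^10))^3
         / (qpoch_inf (q^2) (q^2) * (qpoch_inf (q^5) (q^5))^2)
       * qpochs_inf [-q, -(q^4)] (q^5) * (qpochs_inf [q^4, q^6] (q^10))^3)
    \<and> ((qpochs_inf [q, q^4] (q^5))^2 * qpochs_inf [q^4, q^6] (q^10)
       + (qpochs_inf [q^2, q^3] (q^5))^2 * qpochs_inf [q^2, q^8] (q^10)
     = 2 * (qpoch_inf q q)^2 * (qpoch_inf (q^10) (q^10))^4
         / ((qpoch_inf (q^2) (q^2))^2 * (qpoch_inf (q^5) (q^5))^4)
       * qpochs_inf [-q, -(q^4)] (q^5) * (qpochs_inf [q^4, q^6] (q^10))^3)
    \<and> (qpochs_inf [-q, -(q^4)] (q^5) * (qpochs_inf [q^4, q^6] (q^10))^3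
       - q * qpochs_inf [-(q^2), -(q^3)] (q^5) * (qpochs_inf [q^2, q^8] (q^10))^3
     = qpoch_inf (q^2) (q^2) * (qpoch_inf (q^5) (q^5))^2
         / (qpoch_inf (q^10) (q^10))^3
       * (qpochs_inf [-(q^2), -(q^3)] (q^5))^2 * qpochs_inf [q^2, q^8] (q^10))
    \<and> (qpochs_inf [-q, -(q^4)] (q^5) * (qpochs_inf [q^4, q^6] (q^10))^3
       + q * qpochs_inf [-(q^2), -(q^3)] (q^5) * (qpochs_inf [q^2, q^8] (q^10))^3
     = (qpoch_inf (q^2) (q^2))^2 * (qpoch_inf (q^5) (q^5))^4
         / ((qpoch_inf q q)^2 * (qpoch_inf (q^10) (q^10))^4)
       * (qpochs_inf [q^2, q^3] (q^5))^2 * qpochs_inf [q^2, q^8] (q^10))"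
  \<comment> \<open>The theta products divide by \<open>q\<close>, so \<open>q = 0\<close> is treated separately; there every product is 1.\<close>
proof (cases "q = 0")
  case True
  have "qpoch_inf 0 0 = 1" by (simp add: qpoch_inf_def)
  with True show ?thesis by (simp add: qpochs_inf_def)
next
  case q0: False
  have small: "norm (q ^ k) < 1" if "k > 0" for k
    using assms that by (simp add: norm_power power_less_one_iff)
  have nz: "qpoch_inf (q ^ k) (q ^ k) \<noteq> 0" if "k > 0" for k
    using small[OF that] by (intro qpoch_inf_nonzero)
  define A where "A = theta_prod (-q) (q^5)"
  define B where "B = theta_prod (-(q^2)) (q^5)"
  define a where "a = theta_prod q (q^5)"
  define b where "b = theta_prod (q^2) (q^5)"
  define C where "C = theta_prod (q^4) (q^10)"
  define D where "D = theta_prod (q^2) (q^10)"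
  define g where "g = theta_prod q (q^10)"
  define h where "h = theta_prod (q^3) (q^10)"
  define E1 where "E1 = qpoch_inf q q"
  define E2 where "E2 = qpoch_inf (q^2) (q^2)"
  define E5 where "E5 = qpoch_inf (q^5) (q^5)"
  define E10 where "E10 = qpoch_inf (q^10) (q^10)"
  have qdiv: "q ^ m / q ^ n = q ^ (m - n)" if "n \<le> m" for m n
    using q0 that by (simp add: power_diff)
  have qdiv1: "q ^ m / q = q ^ (m - 1)" if "1 \<le> m" for m
    using q0 that by (simp add: power_diff)
  have qq: "(q^5)^2 = q^10" "(q^2)^2 = q^4" "q * q^2 = q^3" by (simp_all add: eval_nat_numeral)
  note [simp] = qdiv qdiv1
  have lists: "qpochs_inf [-q, -(q^4)] (q^5) = A" "qpochs_inf [-(q^2), -(q^3)] (q^5) = B"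
      "qpochs_inf [q, q^4] (q^5) = a" "qpochs_inf [q^2, q^3] (q^5) = b"
      "qpochs_inf [q^4, q^6] (q^10) = C" "qpochs_inf [q^2, q^8] (q^10) = D"
    by (simp_all add: qpochs_inf_def theta_prod_def A_def B_def a_def b_def C_def D_def)
  have nonzero: "E1 \<noteq> 0" "E2 \<noteq> 0" "E5 \<noteq> 0" "E10 \<noteq> 0"
    using nz[of 1] nz[of 2] nz[of 5] nz[of 10] by (simp_all add: E1_def E2_def E5_def E10_def)
  have D: "D = a * A"
    using theta_prod_mult_uminus[OF small, of 5 q] by (simp add: a_def A_def D_def flip: power_mult)
  have C: "C = b * B"
    using theta_prod_mult_uminus[OF small, of 5 "q^2"] by (simp add: b_def B_def C_def flip: power_mult)
  have E1: "E1 = a * b * E5"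
    using qpoch_inf_quintisect[OF assms q0] by (simp add: E1_def E5_def a_def b_def)
  have E2: "E2 = D * C * E10"
    using qpoch_inf_quintisect[OF small, of 2] q0
    by (simp add: E2_def E10_def D_def C_def flip: power_mult)
  have a: "a = g * C"
    using theta_prod_dissect[OF small, of 5 q] theta_prod_commute[of "q^4" "q^10"] q0
    by (simp add: a_def g_def C_def flip: power_mult power_Suc2 power_Suc)
  have b: "b = D * h"
    using theta_prod_dissect[OF small, of 5 "q^2"] theta_prod_commute[of "q^3" "q^10"] q0
    by (simp add: b_def D_def h_def flip: power_mult power_add)
  have sum: "E5^2 * (a * B + A * b) = 2 * E10^2 * (h * C)"
    using theta_prod_sum[OF small, of 5 q "q^2"] q0
    by (simp add: E5_def a_def B_def A_def b_def E10_def h_def C_def qq flip: power_mult power_add power_Suc2 power_Suc)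
  have diff: "E5^2 * (A * b - a * B) = 2 * q * E10^2 * (D * g)"
    using theta_prod_difference[OF small, of 5 q "q^2"] q0
      theta_prod_commute[of q "q^10"] theta_prod_commute[of "q^2" "q^10"]
    by (simp add: E5_def a_def B_def A_def b_def E10_def g_def D_def qq flip: power_mult power_add power_Suc2 power_Suc)
  \<comment> \<open>The factor \<open>D\<close> of \<open>E2\<close> turns \<open>h\<close> into \<open>b\<close>, and its factor \<open>C\<close> turns \<open>g\<close> into \<open>a\<close>.\<close>
  have plus: "E2 * E5^2 * (a * B + A * b) = 2 * E10^3 * (b^3 * B^2)"
  proof -
    have "E2 * E5^2 * (a * B + A * b) = E2 * (2 * E10^2 * (h * C))"
      by (simp only: mult.assoc [of E2] sum)
    also have "\<dots> = 2 * E10^3 * ((D * h) * C^2)"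
      by (simp add: E2 eval_nat_numeral)
    also have "D * h = b" by (simp add: b)
    finally show ?thesis by (simp add: C eval_nat_numeral)
  qed
  have minus: "E2 * E5^2 * (A * b - a * B) = 2 * E10^3 * (q * a^3 * A^2)"
  proof -
    have "E2 * E5^2 * (A * b - a * B) = E2 * (2 * q * E10^2 * (D * g))"
      by (simp only: mult.assoc [of E2] diff)
    also have "\<dots> = 2 * E10^3 * q * ((g * C) * D^2)"
      by (simp add: E2 eval_nat_numeral)
    also have "g * C = a" by (simp add: a)
    finally show ?thesis by (simp add: D eval_nat_numeral)
  qed
  have id1: "(A^2 * C + B^2 * D) * (E2 * E5^2) = 2 * E10^3 * A * C^3"
  proof -
    have "(A^2 * C + B^2 * D) * (E2 * E5^2) = A * B * (E2 * E5^2 * (a * B + A * b))"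
      by (simp add: C D algebra_simps eval_nat_numeral)
    then show ?thesis unfolding plus by (simp add: C eval_nat_numeral)
  qed
  have id2: "(a^2 * C + b^2 * D) * (E2^2 * E5^4) = 2 * E1^2 * E10^4 * A * C^3"
  proof -
    have "(a^2 * C + b^2 * D) * (E2^2 * E5^4) = a * b * E2 * E5^2 * (E2 * E5^2 * (a * B + A * b))"
      by (simp add: C D algebra_simps eval_nat_numeral)
    then show ?thesis unfolding plus by (simp add: C D E1 E2 eval_nat_numeral)
  qed
  have id3: "E10^3 * (A * C^3 - q * B * D^3) = E2 * E5^2 * B^2 * D"
  proof -
    have "2 * (E10^3 * (A * C^3 - q * B * D^3))
        = A * B * (2 * E10^3 * (b^3 * B^2) - 2 * E10^3 * (q * a^3 * A^2))"
      by (simp add: C D algebra_simps eval_nat_numeral)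
    also have "\<dots> = 2 * (E2 * E5^2 * B^2 * D)"
      unfolding plus [symmetric] minus [symmetric] by (simp add: D algebra_simps eval_nat_numeral)
    finally show ?thesis by simp
  qed
  have id4: "(E1^2 * E10^4) * (A * C^3 + q * B * D^3) = E2^2 * E5^4 * b^2 * D"
  proof -
    have "2 * ((E1^2 * E10^4) * (A * C^3 + q * B * D^3))
        = E1^2 * E10 * A * B * (2 * E10^3 * (b^3 * B^2) + 2 * E10^3 * (q * a^3 * A^2))"
      by (simp add: C D algebra_simps eval_nat_numeral)
    also have "\<dots> = 2 * (E1^2 * E10 * A * B * E2 * E5^2 * (A * b))"
      unfolding plus [symmetric] minus [symmetric] by (simp add: algebra_simps eval_nat_numeral)
    also have "\<dots> = 2 * (E2^2 * E5^4 * b^2 * D)"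
      by (simp add: C D E1 E2 eval_nat_numeral)
    finally show ?thesis by simp
  qed
  show ?thesis
    unfolding lists E1_def[symmetric] E2_def[symmetric] E5_def[symmetric] E10_def[symmetric]
  proof (intro conjI)
    show "A^2 * C + B^2 * D = 2 * E10^3 / (E2 * E5^2) * A * C^3"
      using id1 nonzero by (simp add: field_simps)
    show "a^2 * C + b^2 * D = 2 * E1^2 * E10^4 / (E2^2 * E5^4) * A * C^3"
      using id2 nonzero by (simp add: field_simps)
    show "A * C^3 - q * B * D^3 = E2 * E5^2 / E10^3 * B^2 * D"
      using id3 nonzero by (simp add: field_simps)
    show "A * C^3 + q * B * D^3 = E2^2 * E5^4 / (E1^2 * E10^4) * b^2 * D"
      using id4 nonzero by (simp add: field_simps)
  qed
qed

end
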